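(* Let $G = \mathrm{GL}(n,\mathbb{R}) \ltimes \mathbb{R}^n$. If $x \in \mathrm{GL}(n,\mathbb{R})$ is rational in $\mathrm{GL}(n,\mathbb{R})$, then $xv \in G$ is rational in $G$ for all $v \in \mathbb{R}^n$.
   Context: $G$ is the affine group, realised as the group of matrices $\begin{pmatrix} x & v \\ 0 & 1\end{pmatrix}$ with $x \in \mathrm{GL}(n,\mathbb{R})$ and $v \in \mathbb{R}^n$; the element $xv \in G$ denotes the matrix $\begin{pmatrix} x & v \\ 0 & 1\end{pmatrix}$. An element $g$ of a group $G$ is \emph{rational} in $G$ if every $y \in G$ with $\langle y\rangle = \langle g\rangle$ is $G$-conjugate to $g$; equivalently, if $g$ has finite order, $g$ is conjugate to $g^k$ for every integer $k$ coprime to the order of $g$, and if $g$ has infinite order, $g$ is conjugate to $g^{-1}$. *)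

theory Defs
  imports "HOL-Analysis.Analysis" "HOL-Algebra.Generated_Groups"
begin

definition rational_in :: "('a, 'b) monoid_scheme \<Rightarrow> 'a \<Rightarrow> bool" where
  "rational_in G g \<longleftrightarrow> g \<in> carrier G \<and>
     (\<forall>y\<in>carrier G. generate G {y} = generate G {g} \<longrightarrow>
        (\<exists>h\<in>carrier G. y = h \<otimes>\<^bsub>G\<^esub> g \<otimes>\<^bsub>G\<^esub> inv\<^bsub>G\<^esub> h))"

definition GL :: "(real^'n^'n) monoid" where
  "GL = \<lparr>carrier = {x. invertible x}, mult = (**), one = mat 1\<rparr>"

(* The block matrix with rows (x v) and (0 1). The index type 'n option has one element
   more than 'n: Some i are the first n indices, None is the last one. *)
definition affine_mat :: "real^'n^'n \<Rightarrow> real^'n \<Rightarrow> real^('n option)^('n option)" where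
  "affine_mat x v = (\<chi> i j.
     case i of
       Some a \<Rightarrow> (case j of Some b \<Rightarrow> x $ a $ b | None \<Rightarrow> v $ a)
     | None \<Rightarrow> (case j of Some b \<Rightarrow> 0 | None \<Rightarrow> 1))"

definition AGL :: "(real^('n::finite option)^('n option)) monoid" where
  "AGL = \<lparr>carrier = {affine_mat x v | x v. invertible x}, mult = (**), one = mat 1\<rparr>"

lemma affine_mat_mult:
  "affine_mat x v ** affine_mat y w = affine_mat (x ** y) (x *v w + v)"
  by (simp add: vec_eq_iff affine_mat_def matrix_matrix_mult_def matrix_vector_mult_def
      UNIV_option_conv sum.reindex split: option.split)

lemma affine_mat_one: "affine_mat (mat 1) 0 = mat 1"
  by (simp add: vec_eq_iff affine_mat_def mat_def split: option.split)

lemma affine_mat_inject: "affine_mat x v = affine_mat y w \<longleftrightarrow> x = y \<and> v = w"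
proof
  assume eq: "affine_mat x v = affine_mat y w"
  have "x $ a $ b = y $ a $ b" for a b
    using arg_cong[OF eq, of "\<lambda>m. m $ Some a $ Some b"] by (simp add: affine_mat_def)
  moreover have "v $ a = w $ a" for a
    using arg_cong[OF eq, of "\<lambda>m. m $ Some a $ None"] by (simp add: affine_mat_def)
  ultimately show "x = y \<and> v = w" by (simp add: vec_eq_iff)
qed auto

lemma invertible_one: "invertible (mat 1 :: real^'n^'n)"
  by (auto simp: invertible_def)

lemma group_GL: "group (GL :: (real^'n^'n) monoid)"
proof (rule groupI)
  fix x :: "real^'n^'n" assume "x \<in> carrier GL"
  then obtain y where "x ** y = mat 1" "y ** x = mat 1"
    by (auto simp: GL_def invertible_def)
  then show "\<exists>y\<in>carrier GL. y \<otimes>\<^bsub>GL\<^esub> x = \<one>\<^bsub>GL\<^esub>"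
    by (auto simp: GL_def invertible_def)
qed (auto simp: GL_def matrix_mul_assoc invertible_mult invertible_one)

lemma group_AGL: "group (AGL :: (real^('n::finite option)^('n option)) monoid)"
proof (rule groupI)
  fix g h :: "real^('n option)^('n option)" assume "g \<in> carrier AGL" "h \<in> carrier AGL"
  then show "g \<otimes>\<^bsub>AGL\<^esub> h \<in> carrier AGL"
    by (auto simp: AGL_def affine_mat_mult) (blast intro: invertible_mult)
next
  show "\<one>\<^bsub>AGL\<^esub> \<in> carrier (AGL :: (real^('n option)^('n option)) monoid)"
    by (auto simp: AGL_def affine_mat_one[symmetric] affine_mat_inject invertible_def
        intro!: exI[of _ "mat 1"])
next
  fix g :: "real^('n option)^('n option)" assume "g \<in> carrier AGL"
  then obtain x v where g: "g = affine_mat x v" and "invertible x" by (auto simp: AGL_def)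
  then obtain y where y: "x ** y = mat 1" "y ** x = mat 1" by (auto simp: invertible_def)
  then have "affine_mat y (- (y *v v)) \<in> carrier AGL" by (auto simp: AGL_def invertible_def)
  moreover have "affine_mat y (- (y *v v)) \<otimes>\<^bsub>AGL\<^esub> g = \<one>\<^bsub>AGL\<^esub>"
    by (simp add: AGL_def g affine_mat_mult y affine_mat_one)
  ultimately show "\<exists>h\<in>carrier AGL. h \<otimes>\<^bsub>AGL\<^esub> g = \<one>\<^bsub>AGL\<^esub>" by blast
qed (auto simp: AGL_def matrix_mul_assoc)

end

theory Submission
  imports Defs
begin

text \<open>
  Write \<open>g = xv\<close>, and let \<open>y = x'v'\<close> generate the same cyclic group. Taking linear parts, \<open>x'\<close> and
  \<open>x\<close> generate the same cyclic group, so \<open>x' = h x h\<^sup>-\<^sup>1\<close> for some \<open>h\<close> by rationality of \<open>x\<close>; only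
  the translation parts have to be matched.

  If \<open>g\<close> has finite order, so has \<open>y\<close>, and both affine maps have a fixed point, the centroid of
  an orbit. Moving the fixed points to the origin reduces the claim to the conjugacy of \<open>x\<close> and \<open>x'\<close>.

  If \<open>g\<close> has infinite order, then \<open>y = g\<close> or \<open>y = g\<^sup>-\<^sup>1\<close>, and the second case is the essential one. Put
  \<open>N = x - 1\<close>. Conjugating by a translation changes the translation part of an element with
  linear part \<open>x\<close> by an arbitrary vector of \<open>range N\<close>, and \<open>- x\<^sup>-\<^sup>1 v\<close> is congruent to \<open>- v\<close> modulo that
  range. So what is needed is an invertible \<open>h'\<close> with \<open>h' x = x\<^sup>-\<^sup>1 h'\<close> that maps \<open>v\<close> to \<open>- v\<close> modulo
  \<open>range N\<close>. The given \<open>h\<close> has the first property, and it is corrected by an element of the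
  centralizer of \<open>x\<close>.

  If \<open>v\<close> lies in \<open>range N\<close>, there is nothing to correct. Otherwise replace \<open>v\<close> by a vector
  \<open>v'\<close> congruent to it modulo \<open>range N\<close> and killed by the least possible power \<open>N\<^sup>m\<^sup>+\<^sup>1\<close>
  (\<open>ex_exact_height_representative\<close>). Minimality gives \<open>N\<^sup>m v' \<notin> range N\<^sup>m\<^sup>+\<^sup>1\<close>: in the language of modules
  over the polynomial ring, \<open>v'\<close> generates a direct summand that is a single Jordan block of size
  \<open>m + 1\<close>. The vector \<open>- h v'\<close> has the same two properties, and the centralizer of \<open>x\<close> acts transitively
  on such vectors modulo \<open>range N\<close> (\<open>centralizer_transitive_mod_range\<close>).
\<close>

section \<open>Vectors of exact height in a nilpotent direction\<close>

lemma linear_funpow: "linear N \<Longrightarrow> linear (N ^^ i)" for N :: "'a::real_vector \<Rightarrow> 'a"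
proof (induction i)
  case 0 then show ?case by (simp add: id_def linear_ident)
next
  case (Suc i) then show ?case using linear_compose[of "N ^^ i" N] by (simp add: o_def)
qed

text \<open>
  Modulo \<open>S\<close> both vectors are nonzero, so represent them by nonzero \<open>p'\<close> and \<open>q'\<close> orthogonal to \<open>S\<close>. Unless
  \<open>p'\<close> and \<open>q'\<close> are orthogonal to each other, \<open>p'\<close> itself represents a suitable functional; if they
  are, \<open>p' + q'\<close> does.
\<close>

lemma ex_common_nonvanishing_functional:
  fixes p q :: "'a::euclidean_space"
  assumes S: "subspace S" and "p \<notin> S" "q \<notin> S"
  shows "\<exists>a. (\<forall>s\<in>S. a \<bullet> s = 0) \<and> a \<bullet> p \<noteq> 0 \<and> a \<bullet> q \<noteq> 0"
proof -
  have decomp: "\<exists>d. (\<forall>s\<in>S. d \<bullet> s = 0) \<and> d \<noteq> 0 \<and> r - d \<in> S" if "r \<notin> S" for r :: 'a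
  proof -
    obtain s d where "s \<in> span S" "\<And>w. w \<in> span S \<Longrightarrow> orthogonal d w" "r = s + d"
      using orthogonal_subspace_decomp_exists[of S r] by metis
    moreover have "span S = S" using S by (simp add: span_eq_iff)
    ultimately show ?thesis using that
      by (intro exI[of _ d]) (auto simp: orthogonal_def)
  qed
  obtain p' where p': "\<And>s. s \<in> S \<Longrightarrow> p' \<bullet> s = 0" "p' \<noteq> 0" "p - p' \<in> S"
    using decomp[OF \<open>p \<notin> S\<close>] by blast
  obtain q' where q': "\<And>s. s \<in> S \<Longrightarrow> q' \<bullet> s = 0" "q' \<noteq> 0" "q - q' \<in> S"
    using decomp[OF \<open>q \<notin> S\<close>] by blast
  have "p' \<bullet> (p - p') = 0" "q' \<bullet> (p - p') = 0" "p' \<bullet> (q - q') = 0" "q' \<bullet> (q - q') = 0"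
    using p' q' by blast+
  then have eqs: "p' \<bullet> p = p' \<bullet> p'" "q' \<bullet> p = q' \<bullet> p'" "p' \<bullet> q = p' \<bullet> q'" "q' \<bullet> q = q' \<bullet> q'"
    by (simp_all add: inner_diff_right)
  show ?thesis
  proof (cases "p' \<bullet> q' = 0")
    case False
    then show ?thesis using p' eqs by (intro exI[of _ p']) simp
  next
    case True
    then have "q' \<bullet> p' = 0" by (simp add: inner_commute)
    with True show ?thesis using p' q' eqs
      by (intro exI[of _ "p' + q'"]) (simp add: inner_add_left)
  qed
qed

text \<open>
  Here is the correcting element of the centralizer. A vector \<open>a\<close> orthogonal to \<open>range N\<^sup>m\<^sup>+\<^sup>1\<close>
  and a vector \<open>b\<close> killed by \<open>N\<^sup>m\<^sup>+\<^sup>1\<close> define an endomorphism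
  \<open>A w = (\<Sum>i\<le>m. (a \<bullet> N\<^sup>m\<^sup>-\<^sup>i w) N\<^sup>i b)\<close>, which commutes with \<open>N\<close> because composing with
  \<open>N\<close> on either side shifts the sum by one place and the terms at both ends vanish. Modulo \<open>range N\<close>, \<open>1 + A\<close> sends
  \<open>u\<close> to \<open>u + (a \<bullet> N\<^sup>m u) b\<close>, so \<open>b\<close> has to be the multiple of \<open>v - u\<close> that turns
  this into \<open>v\<close>.

  A nonzero kernel of \<open>1 + A\<close> would consist of \<open>N\<close>-nilpotent vectors, hence contain some \<open>w0 \<noteq> 0\<close>
  with \<open>N w0 = 0\<close>. On the kernel of \<open>N\<close> only the last term of \<open>A\<close> survives, and this forces
  \<open>a \<bullet> N\<^sup>m b = -1\<close>, that is, \<open>a \<bullet> N\<^sup>m v = 0\<close>. So \<open>a\<close> is chosen with both \<open>a \<bullet> N\<^sup>m u\<close> and \<open>a \<bullet> N\<^sup>m v\<close> nonzero.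
\<close>

lemma centralizer_transitive_mod_range:
  fixes N :: "'a::euclidean_space \<Rightarrow> 'a"
  assumes N: "linear N"
    and u: "(N ^^ Suc m) u = 0" "(N ^^ m) u \<notin> range (N ^^ Suc m)"
    and v: "(N ^^ Suc m) v = 0" "(N ^^ m) v \<notin> range (N ^^ Suc m)"
  shows "\<exists>z. linear z \<and> inj z \<and> (\<forall>w. z (N w) = N (z w)) \<and> z u - v \<in> range N"
proof -
  have lin: "linear (N ^^ i)" for i by (rule linear_funpow[OF N])
  have "subspace (range (N ^^ Suc m))"
    by (rule linear_subspace_image[OF lin subspace_UNIV])
  then obtain a where a: "\<And>w. a \<bullet> (N ^^ Suc m) w = 0"
      and au: "a \<bullet> (N ^^ m) u \<noteq> 0" and av: "a \<bullet> (N ^^ m) v \<noteq> 0"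
    using ex_common_nonvanishing_functional[OF _ u(2) v(2)] by blast
  define b where "b = (1 / (a \<bullet> (N ^^ m) u)) *\<^sub>R (v - u)"
  define A where "A w = (\<Sum>i\<le>m. (a \<bullet> (N ^^ (m - i)) w) *\<^sub>R (N ^^ i) b)" for w
  define z where "z w = w + A w" for w
  have b0: "(N ^^ Suc m) b = 0"
    using u(1) v(1) linear_scale[OF lin[of "Suc m"]] linear_diff[OF lin[of "Suc m"]]
    by (simp add: b_def del: funpow.simps)
  have linA: "linear A"
    unfolding A_def
    by (intro linear_compose_sum ballI linearI)
       (simp_all add: linear_add[OF lin] linear_scale[OF lin] inner_add_right scaleR_add_left)
  have linz: "linear z"
    unfolding z_def using linA by (intro linear_compose_add linear_ident)
  have AN: "A (N w) = N (A w)" for w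
  proof -
    let ?t = "\<lambda>i. (a \<bullet> (N ^^ (Suc m - i)) w) *\<^sub>R (N ^^ i) b"
    have "A (N w) = (\<Sum>i\<le>m. ?t i)"
      unfolding A_def by (intro sum.cong refl) (simp add: Suc_diff_le funpow_Suc_right del: funpow.simps)
    also have "\<dots> = (\<Sum>i\<le>Suc m. ?t i)" using b0 by (simp del: funpow.simps)
    also have "\<dots> = ?t 0 + (\<Sum>i\<le>m. ?t (Suc i))" by (rule sum.atMost_Suc_shift)
    also have "?t 0 = 0" using a by (simp del: funpow.simps)
    finally show ?thesis
      unfolding A_def by (simp add: linear_sum[OF N] linear_scale[OF N])
  qed
  have zN: "z (N w) = N (z w)" for w
    by (simp add: z_def AN linear_add[OF N])
  have zNj: "z ((N ^^ j) w) = (N ^^ j) (z w)" for j w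
    by (induction j) (simp_all add: zN)
  have "inj z"
    unfolding linear_injective_0[OF linz]
  proof (intro allI impI, rule ccontr)
    fix w assume zw: "z w = 0" and "w \<noteq> 0"
    (* On this vector every coefficient of A pairs the vector a with an element of range (N ^^ Suc m). *)
    have "A ((N ^^ Suc m) w) = 0"
      unfolding A_def
    proof (intro sum.neutral ballI)
      fix i
      have "(N ^^ (m - i)) ((N ^^ Suc m) w) = (N ^^ Suc m) ((N ^^ (m - i)) w)"
        by (metis add.commute comp_apply funpow_add)
      then show "(a \<bullet> (N ^^ (m - i)) ((N ^^ Suc m) w)) *\<^sub>R (N ^^ i) b = 0"
        using a by (simp del: funpow.simps)
    qed
    moreover have "z ((N ^^ Suc m) w) = 0"
      unfolding zNj zw by (rule linear_0[OF lin])
    ultimately have nil: "(N ^^ Suc m) w = 0" by (simp add: z_def del: funpow.simps)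
    (* The last nonzero vector among w, N w, N (N w), ... lies in the kernel of N and of z. *)
    define j where "j = (LEAST j. (N ^^ j) w = 0)"
    have j0: "(N ^^ j) w = 0" unfolding j_def using nil by (rule LeastI)
    then obtain t where t: "j = Suc t" using \<open>w \<noteq> 0\<close> by (cases j) auto
    define w0 where "w0 = (N ^^ t) w"
    have "w0 \<noteq> 0" unfolding w0_def using not_less_Least[of t "\<lambda>j. (N ^^ j) w = 0"] t
      by (simp add: j_def)
    have Nw0: "N w0 = 0" using j0 t by (simp add: w0_def)
    have zw0: "z w0 = 0" unfolding w0_def zNj zw by (rule linear_0[OF lin])
    have Nw0i: "(N ^^ i) w0 = 0" if "i > 0" for i
      using that
    proof (induction i)
      case (Suc i)
      then show ?case by (cases i) (simp_all add: Nw0 linear_0[OF N])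
    qed simp
    have "A w0 = (a \<bullet> w0) *\<^sub>R (N ^^ m) b"
      unfolding A_def by (subst sum.remove[of _ m]) (auto intro!: sum.neutral simp: Nw0i)
    then have w0: "w0 = - ((a \<bullet> w0) *\<^sub>R (N ^^ m) b)"
      using zw0 by (simp add: z_def eq_neg_iff_add_eq_0)
    then have aw0: "a \<bullet> w0 \<noteq> 0" using \<open>w0 \<noteq> 0\<close> by auto
    have "a \<bullet> w0 = - (a \<bullet> w0) * (a \<bullet> (N ^^ m) b)"
      using arg_cong[OF w0, of "\<lambda>w. a \<bullet> w"] by simp
    then have "(a \<bullet> w0) * (a \<bullet> (N ^^ m) b + 1) = 0" by (simp add: algebra_simps)
    then have "a \<bullet> (N ^^ m) b = -1" using aw0 by (simp add: add_eq_0_iff)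
    moreover have "a \<bullet> (N ^^ m) b = (a \<bullet> (N ^^ m) v) / (a \<bullet> (N ^^ m) u) - 1"
      using au by (simp add: b_def linear_scale[OF lin] linear_diff[OF lin] inner_diff_right
          diff_divide_distrib)
    ultimately show False using av au by simp
  qed
  moreover have "z u - v \<in> range N"
  proof -
    have "A u = (a \<bullet> (N ^^ m) u) *\<^sub>R b + (\<Sum>i<m. (a \<bullet> (N ^^ (m - Suc i)) u) *\<^sub>R N ((N ^^ i) b))"
      unfolding A_def sum.atMost_shift by simp
    also have "(a \<bullet> (N ^^ m) u) *\<^sub>R b = v - u" using au by (simp add: b_def)
    also have "(\<Sum>i<m. (a \<bullet> (N ^^ (m - Suc i)) u) *\<^sub>R N ((N ^^ i) b))
        = N (\<Sum>i<m. (a \<bullet> (N ^^ (m - Suc i)) u) *\<^sub>R (N ^^ i) b)"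
      by (simp add: linear_sum[OF N] linear_scale[OF N])
    finally show ?thesis by (simp add: z_def)
  qed
  ultimately show ?thesis using linz zN by blast
qed

text \<open>
  The range of \<open>N\<^sup>i\<close> shrinks as \<open>i\<close> grows, so it is constant from any exponent on where its dimension is
  minimal among positive exponents.
\<close>

lemma ex_power_range_stable:
  fixes N :: "'a::euclidean_space \<Rightarrow> 'a"
  assumes N: "linear N"
  shows "\<exists>k>0. range (N ^^ (k + k)) = range (N ^^ k)"
proof -
  have lin: "linear (N ^^ i)" for i by (rule linear_funpow[OF N])
  have sub: "subspace (range (N ^^ i))" for i
    by (rule linear_subspace_image[OF lin subspace_UNIV])
  define d where "d i = dim (range (N ^^ i))" for i
  obtain k where k: "\<And>i. d (Suc k) \<le> d (Suc i)"
    using ex_has_least_nat[of "\<lambda>_. True" _ "\<lambda>i. d (Suc i)"] by auto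
  have "range (N ^^ (Suc k + Suc k)) \<subseteq> range (N ^^ Suc k)"
    unfolding funpow_add by auto
  moreover have "d (Suc k) \<le> d (Suc k + Suc k)" using k[of "k + Suc k"] by simp
  ultimately have "range (N ^^ (Suc k + Suc k)) = range (N ^^ Suc k)"
    unfolding d_def by (intro subspace_dim_equal sub) auto
  then show ?thesis by blast
qed

text \<open>
  Once \<open>range N\<^sup>k = range N\<^sup>2\<^sup>k\<close>, Fitting's decomposition makes every vector a sum of one killed by \<open>N\<^sup>k\<close> and
  one in \<open>range N\<^sup>k\<close>; so every class modulo \<open>range N\<close> has representatives killed by some power of
  \<open>N\<close>. Let \<open>m + 1\<close> be the least exponent that occurs and \<open>v'\<close> a representative for it. If \<open>N\<^sup>m v' = N\<^sup>m\<^sup>+\<^sup>1 w\<close>, then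
  \<open>v' - N w\<close> would be a representative killed by \<open>N\<^sup>m\<close>.
\<close>

lemma ex_exact_height_representative:
  fixes N :: "'a::euclidean_space \<Rightarrow> 'a"
  assumes N: "linear N" and v: "v \<notin> range N"
  shows "\<exists>m v'. v' - v \<in> range N \<and> (N ^^ Suc m) v' = 0 \<and> (N ^^ m) v' \<notin> range (N ^^ Suc m)"
proof -
  have lin: "linear (N ^^ i)" for i by (rule linear_funpow[OF N])
  let ?P = "\<lambda>k. \<exists>v'. v' - v \<in> range N \<and> (N ^^ k) v' = 0"
  have "\<exists>k. ?P k"
  proof -
    obtain k where "k > 0" and k: "range (N ^^ (k + k)) = range (N ^^ k)"
      using ex_power_range_stable[OF N] by blast
    then obtain l where l: "k = Suc l" by (cases k) auto
    obtain w where w: "(N ^^ k) v = (N ^^ (k + k)) w" using k by (metis rangeE rangeI)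
    have "(N ^^ k) (v - (N ^^ k) w) = 0"
      using w by (simp add: linear_diff[OF lin] funpow_add)
    moreover have "(v - (N ^^ k) w) - v = N (- (N ^^ l) w)"
      by (simp add: l linear_neg[OF N])
    ultimately show ?thesis by (metis rangeI)
  qed
  define k where "k = (LEAST k. ?P k)"
  have "?P k" unfolding k_def by (rule LeastI_ex) fact
  then obtain v' where v': "v' - v \<in> range N" "(N ^^ k) v' = 0" by blast
  have "k \<noteq> 0"
  proof
    assume "k = 0"
    then obtain s where "- v = N s" using v' by auto
    then have "v = N (- s)" using linear_neg[OF N, of s] by (metis minus_minus)
    with v show False by blast
  qed
  then obtain m where m: "k = Suc m" by (cases k) auto
  have "(N ^^ m) v' \<notin> range (N ^^ Suc m)"
  proof
    assume "(N ^^ m) v' \<in> range (N ^^ Suc m)"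
    then obtain w where "(N ^^ m) v' = (N ^^ m) (N w)" by (auto simp: funpow_Suc_right simp del: funpow.simps)
    then have "(N ^^ m) (v' - N w) = 0" by (simp add: linear_diff[OF lin])
    moreover have "(v' - N w) - v \<in> range N"
    proof -
      obtain s where "v' - v = N s" using v'(1) by blast
      then have "(v' - N w) - v = N (s - w)" by (simp add: linear_diff[OF N] algebra_simps)
      then show ?thesis by blast
    qed
    ultimately have "?P m" by blast
    then show False using not_less_Least[of m ?P] m by (simp add: k_def)
  qed
  with v' m show ?thesis by blast
qed

section \<open>Reversing a linear map together with a vector\<close>

text \<open>
  The bijection \<open>c = - Y\<close> commutes with \<open>N = X - 1\<close>, and \<open>N h = h N c\<close> because \<open>Y - 1 = - Y N\<close>. Hence
  \<open>h\<close> preserves the kernel and the range of each power of \<open>N\<close>, and \<open>- h v'\<close> has the same exact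
  height as \<open>v'\<close>. An element \<open>z\<close> of the centralizer of \<open>X\<close> that moves \<open>- h v'\<close> to \<open>v'\<close> modulo
  \<open>range N\<close> makes \<open>h' = z h\<close> a solution; \<open>h' v\<close> may be computed from \<open>h' v'\<close> since \<open>h'\<close> preserves
  \<open>range N\<close> too.
\<close>

lemma ex_reverser_negating_mod_range:
  fixes X Y h :: "'a::euclidean_space \<Rightarrow> 'a"
  assumes X: "linear X" and Y: "linear Y" and h: "linear h" "inj h"
    and XY: "\<And>w. X (Y w) = w" and YX: "\<And>w. Y (X w) = w"
    and hX: "\<And>w. h (X w) = Y (h w)"
  shows "\<exists>h' s. linear h' \<and> inj h' \<and> (\<forall>w. h' (X w) = Y (h' w)) \<and> h' v + v = X s - s"
proof -
  define N where "N w = X w - w" for w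
  have N: "linear N" unfolding N_def by (intro linear_compose_sub X linear_ident)
  define c where "c w = - Y w" for w
  have c: "linear c" unfolding c_def by (intro linear_compose_neg Y)
  have hY: "h (Y w) = X (h w)" for w
    by (metis hX XY)
  have cN: "c (N w) = N (c w)" for w
    by (simp add: c_def N_def linear_diff[OF Y] linear_neg[OF X] XY YX)
  have Nh: "N (h w) = h (N (c w))" for w
    by (simp add: c_def N_def linear_diff[OF h(1)] linear_neg[OF h(1)] linear_neg[OF X] hY XY)
  have Nch: "(N ^^ i) (c w) = c ((N ^^ i) w)" for i w
    by (induction i) (simp_all add: cN)
  have Nhi: "(N ^^ i) (h w) = h ((c ^^ i) ((N ^^ i) w))" for i w
  proof (induction i)
    case (Suc i)
    have "c (N ((c ^^ i) y)) = (c ^^ Suc i) (N y)" for y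
      by (induction i) (simp_all add: cN)
    then show ?case using Suc by (simp add: Nh cN[symmetric])
  qed simp
  have inj_c: "inj c"
    by (rule injI) (metis c_def XY neg_equal_iff_equal)
  have inj_ci: "inj (c ^^ i)" for i
    using inj_c by (rule inj_fn)
  show ?thesis
  proof (cases "v \<in> range N")
    case True
    then obtain r where r: "v = N r" by blast
    have "h v + v = X (r - Y (h r)) - (r - Y (h r))"
      by (simp add: r N_def linear_diff[OF h(1)] linear_diff[OF X] hX XY)
    with h hX show ?thesis by blast
  next
    case False
    obtain m v' where v': "v' - v \<in> range N" "(N ^^ Suc m) v' = 0"
        "(N ^^ m) v' \<notin> range (N ^^ Suc m)"
      using ex_exact_height_representative[OF N False] by blast
    define u where "u = h (- v')"
    have lin: "linear (N ^^ i)" "linear (c ^^ i)" for i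
      by (intro linear_funpow N c)+
    have "(N ^^ Suc m) u = 0"
      unfolding u_def Nhi
      using v'(2) by (simp add: linear_neg[OF lin(1)] linear_0[OF lin(2)] linear_0[OF h(1)]
          del: funpow.simps)
    moreover have "(N ^^ m) u \<notin> range (N ^^ Suc m)"
    proof
      assume "(N ^^ m) u \<in> range (N ^^ Suc m)"
      then obtain w where w: "(N ^^ m) u = (N ^^ Suc m) w" by blast
      obtain y where y: "w = h y"
        using linear_injective_imp_surjective[OF h] by (metis surjD)
      have "h ((c ^^ m) ((N ^^ m) (- v'))) = h ((c ^^ Suc m) ((N ^^ Suc m) y))"
        using w unfolding u_def y Nhi .
      then have "(c ^^ m) ((N ^^ m) (- v')) = (c ^^ m) (c ((N ^^ Suc m) y))"
        using h(2) by (simp add: inj_eq funpow_Suc_right del: funpow.simps)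
      then have "(N ^^ m) (- v') = c ((N ^^ Suc m) y)"
        using inj_ci by (simp add: inj_eq del: funpow.simps)
      then have "(N ^^ m) v' = (N ^^ Suc m) (- c y)"
        unfolding Nch[symmetric] linear_neg[OF lin(1)] by (metis minus_minus)
      with v'(3) show False by blast
    qed
    ultimately obtain z where z: "linear z" "inj z" "\<And>w. z (N w) = N (z w)"
        "z u - v' \<in> range N"
      using centralizer_transitive_mod_range[OF N _ _ v'(2,3)] by blast
    have zX: "z (X w) = X (z w)" for w
      using z(3)[of w] by (simp add: N_def linear_diff[OF z(1)])
    have zY: "z (Y w) = Y (z w)" for w
      by (metis zX XY YX)
    define h' where "h' w = z (h w)" for w
    have h': "linear h'" "inj h'"
      unfolding h'_def using linear_compose[OF h(1) z(1)] inj_compose[OF z(2) h(2)]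
      by (simp_all add: o_def)
    have h'X: "h' (X w) = Y (h' w)" for w by (simp add: h'_def hX zY)
    obtain r where r: "v' - v = N r" using v'(1) by blast
    obtain t where t: "z u - v' = N t" using z(4) by blast
    have h'N: "h' (N w) = N (- Y (h' w))" for w
      by (simp add: N_def linear_diff[OF h'(1)] linear_neg[OF X] h'X XY)
    have "- h' v' - v' = N t"
      using t by (simp add: u_def h'_def linear_neg[OF h(1)] linear_neg[OF z(1)])
    then have "h' v' = - v' - N t"
      by (metis add.commute diff_add_cancel minus_diff_eq uminus_add_conv_diff)
    moreover have "h' v = h' v' - h' (N r)"
      using r by (simp add: linear_diff[OF h'(1), symmetric] algebra_simps)
    ultimately have "h' v + v = N (- t) + N (- r) - N (- Y (h' r))"
      using r by (simp add: h'N linear_neg[OF N] algebra_simps)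
    also have "\<dots> = N (- t - r + Y (h' r))"
      by (simp add: linear_neg[OF N] linear_add[OF N] linear_diff[OF N])
    finally show ?thesis using h' h'X by (auto simp: N_def)
  qed
qed

section \<open>Conjugacy in the affine group\<close>

lemma invertible_imp_affine_mat_in_AGL: "invertible x \<Longrightarrow> affine_mat x v \<in> carrier AGL"
  by (auto simp: AGL_def)

lemma mult_AGL_affine_mat:
  "affine_mat x v \<otimes>\<^bsub>AGL\<^esub> affine_mat y w = affine_mat (x ** y) (x *v w + v)"
  by (simp add: AGL_def affine_mat_mult)

text \<open>
  The last two hypotheses are the two components of the equation
  \<open>(hw) (xv) = (yu) (hw)\<close> for the conjugating element \<open>hw\<close>.
\<close>

lemma affine_conjugateI:
  assumes "invertible x" "invertible y" "invertible h"
    and "h ** x = y ** h" and "h *v v + w = y *v w + u"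
  shows "\<exists>k\<in>carrier AGL. affine_mat y u = k \<otimes>\<^bsub>AGL\<^esub> affine_mat x v \<otimes>\<^bsub>AGL\<^esub> inv\<^bsub>AGL\<^esub> k"
proof -
  interpret AGL: group "AGL :: (real^('a option)^('a option)) monoid" by (rule group_AGL)
  have "affine_mat h w \<otimes>\<^bsub>AGL\<^esub> affine_mat x v = affine_mat y u \<otimes>\<^bsub>AGL\<^esub> affine_mat h w"
    using assms by (simp add: mult_AGL_affine_mat)
  then have "affine_mat y u = affine_mat h w \<otimes>\<^bsub>AGL\<^esub> affine_mat x v \<otimes>\<^bsub>AGL\<^esub> inv\<^bsub>AGL\<^esub> affine_mat h w"
    using assms by (simp add: AGL.inv_solve_right invertible_imp_affine_mat_in_AGL)
  then show ?thesis using assms(3) invertible_imp_affine_mat_in_AGL by blast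
qed

text \<open>
  The affine map permutes the images \<open>t 0, \<dots>, t (m - 1)\<close> of the origin cyclically, hence fixes their
  centroid.
\<close>

lemma finite_order_imp_fixed_point:
  assumes "invertible x" "m > 0" and pow: "affine_mat x v [^]\<^bsub>AGL\<^esub> (m::nat) = \<one>\<^bsub>AGL\<^esub>"
  shows "\<exists>p. x *v p + v = p"
proof -
  interpret AGL: group "AGL :: (real^('a option)^('a option)) monoid" by (rule group_AGL)
  define t where "t j = ((\<lambda>q. x *v q + v) ^^ j) 0" for j
  have "\<exists>y. affine_mat x v [^]\<^bsub>AGL\<^esub> j = affine_mat y (t j)" for j :: nat
  proof (induction j)
    case 0
    then show ?case by (auto simp: t_def AGL_def affine_mat_one[symmetric])
  next
    case (Suc j)
    then obtain y where "affine_mat x v [^]\<^bsub>AGL\<^esub> j = affine_mat y (t j)" by blast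
    then have "affine_mat x v [^]\<^bsub>AGL\<^esub> Suc j = affine_mat (x ** y) (t (Suc j))"
      using AGL.nat_pow_Suc2[OF invertible_imp_affine_mat_in_AGL[OF assms(1)], of v j]
      by (simp add: mult_AGL_affine_mat t_def del: AGL.nat_pow_Suc)
    then show ?case by blast
  qed
  from this[of m] obtain y where "affine_mat y (t m) = affine_mat (mat 1) 0"
    unfolding pow by (auto simp: AGL_def affine_mat_one)
  then have tm: "t m = t 0" by (simp add: affine_mat_inject t_def)
  define p where "p = (1 / real m) *\<^sub>R (\<Sum>j<m. t j)"
  have "(\<Sum>j<m. t (Suc j)) = (\<Sum>j<m. t j)"
    using sum.lessThan_Suc_shift[of t m] tm by simp
  moreover have "(\<Sum>j<m. t (Suc j)) = x *v (\<Sum>j<m. t j) + real m *\<^sub>R v"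
    by (simp add: t_def sum.distrib linear_sum[OF matrix_vector_mul_linear] sum_constant_scaleR
        del: sum_constant)
  ultimately have "x *v (\<Sum>j<m. t j) + real m *\<^sub>R v = (\<Sum>j<m. t j)" by simp
  then have "(1 / real m) *\<^sub>R (x *v (\<Sum>j<m. t j) + real m *\<^sub>R v) = p" by (simp add: p_def)
  then have "x *v p + v = p"
    using \<open>m > 0\<close> by (simp add: p_def scaleR_add_right linear_scale[OF matrix_vector_mul_linear])
  then show ?thesis by blast
qed

text \<open>
  With \<open>f v + v = x s - s\<close> for a reverser \<open>f\<close> of \<open>x\<close>, the equation
  \<open>f v + w = y w - y v\<close> for the translation part \<open>w\<close> of the conjugating element reads
  \<open>(1 - y) w = (1 - y) (v - x s)\<close>.
\<close>

lemma reversible_imp_affine_conjugate_inv: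
  fixes x y h :: "real^'n^'n"
  assumes xy: "x ** y = mat 1" "y ** x = mat 1" and h: "invertible h" "h ** x = y ** h"
  shows "\<exists>k\<in>carrier AGL. affine_mat y (- (y *v v)) =
    k \<otimes>\<^bsub>AGL\<^esub> affine_mat x v \<otimes>\<^bsub>AGL\<^esub> inv\<^bsub>AGL\<^esub> k"
proof -
  have "inj ((*v) h)"
    using h(1) by (metis invertible_left_inverse matrix_left_invertible_injective)
  moreover have "h *v (x *v w) = y *v (h *v w)" for w
    using h(2) by (simp add: matrix_vector_mul_assoc)
  moreover have "x *v (y *v w) = w" "y *v (x *v w) = w" for w
    using xy by (simp_all add: matrix_vector_mul_assoc)
  ultimately obtain f s where f: "linear f" "inj f" "\<And>w. f (x *v w) = y *v f w"
      and s: "f v + v = x *v s - s"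
    using ex_reverser_negating_mod_range[of "(*v) x" "(*v) y" "(*v) h" v] by auto
  define k where "k = matrix f"
  have fk: "f w = k *v w" for w using f(1) by (simp add: k_def matrix_works)
  have "inj ((*v) k)" using f(2) by (simp add: fk[abs_def])
  then have k: "invertible k"
    by (metis invertible_left_inverse matrix_left_invertible_injective)
  have comm: "k ** x = y ** k"
    using f(3) by (simp add: matrix_eq fk matrix_vector_mul_assoc[symmetric])
  have "f v = x *v s - s - v" using s by (simp add: algebra_simps)
  then have "k *v v + (v - x *v s) = y *v (v - x *v s) + (- (y *v v))"
    using xy by (simp add: fk[symmetric] matrix_vector_mult_diff_distrib matrix_vector_mul_assoc)
  then show ?thesis
    using xy k comm by (intro affine_conjugateI[where h = k]) (auto simp: invertible_def)
qed

definition linear_part :: "real^('n::finite option)^('n option) \<Rightarrow> real^'n^'n" where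
  "linear_part g = (\<chi> i j. g $ Some i $ Some j)"

lemma linear_part_affine_mat: "linear_part (affine_mat x v) = x"
  by (simp add: linear_part_def affine_mat_def vec_eq_iff)

lemma group_hom_linear_part: "group_hom AGL GL linear_part"
  by (intro group_hom.intro group_hom_axioms.intro group_AGL group_GL)
     (auto simp: hom_def AGL_def GL_def linear_part_affine_mat affine_mat_mult)

theorem corollary5p3:
  fixes x :: "real^'n^'n"
  assumes "x \<in> carrier GL"
    and "rational_in GL x"
  shows "\<forall>v. rational_in AGL (affine_mat x v)"
proof
  fix v :: "real^'n"
  interpret GL: group "GL :: (real^'n^'n) monoid" by (rule group_GL)
  interpret AGL: group "AGL :: (real^('n option)^('n option)) monoid" by (rule group_AGL)
  interpret lp: group_hom AGL GL "linear_part :: _ \<Rightarrow> real^'n^'n" by (rule group_hom_linear_part)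
  define g where "g = affine_mat x v"
  have x: "invertible x" using assms(1) by (simp add: GL_def)
  have g: "g \<in> carrier AGL" unfolding g_def using x by (rule invertible_imp_affine_mat_in_AGL)
  have "\<exists>k\<in>carrier AGL. y = k \<otimes>\<^bsub>AGL\<^esub> g \<otimes>\<^bsub>AGL\<^esub> inv\<^bsub>AGL\<^esub> k"
    if y: "y \<in> carrier AGL" and gen: "generate AGL {y} = generate AGL {g}" for y
  proof -
    obtain x' v' where y_eq: "y = affine_mat x' v'" and x': "invertible x'"
      using y by (auto simp: AGL_def)
    have "generate GL {x'} = generate GL {x}"
      using lp.generate_img[of "{y}"] lp.generate_img[of "{g}"] y g gen
      by (simp add: y_eq g_def linear_part_affine_mat)
    moreover have "x' \<in> carrier GL" using x' by (simp add: GL_def)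
    ultimately obtain h where h: "h \<in> carrier GL" "x' = h \<otimes>\<^bsub>GL\<^esub> x \<otimes>\<^bsub>GL\<^esub> inv\<^bsub>GL\<^esub> h"
      using assms(2) unfolding rational_in_def by blast
    have hx: "h ** x = x' ** h"
    proof -
      have "x' \<otimes>\<^bsub>GL\<^esub> h = h \<otimes>\<^bsub>GL\<^esub> x"
        using h assms(1) by (simp add: GL.m_assoc)
      then show ?thesis by (simp add: GL_def)
    qed
    have h_inv: "invertible h" using h(1) by (simp add: GL_def)
    have "y \<in> generate AGL {g}" "g \<in> generate AGL {y}"
      using gen generate.incl[of y "{y}" AGL] generate.incl[of g "{g}" AGL] by auto
    then obtain k l :: int where k: "y = g [^]\<^bsub>AGL\<^esub> k" and l: "g = y [^]\<^bsub>AGL\<^esub> l"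
      using AGL.generate_pow[OF g] AGL.generate_pow[OF y] by auto
    show ?thesis
    proof (cases "\<exists>m::nat. m > 0 \<and> g [^]\<^bsub>AGL\<^esub> m = \<one>\<^bsub>AGL\<^esub>")
      case True
      then obtain m :: nat where m: "m > 0" "g [^]\<^bsub>AGL\<^esub> m = \<one>\<^bsub>AGL\<^esub>" by blast
      have "y [^]\<^bsub>AGL\<^esub> int m = (g [^]\<^bsub>AGL\<^esub> int m) [^]\<^bsub>AGL\<^esub> k"
        unfolding k using g by (simp add: AGL.int_pow_pow mult.commute)
      then have ym: "y [^]\<^bsub>AGL\<^esub> m = \<one>\<^bsub>AGL\<^esub>"
        using m(2) by (simp add: int_pow_int)
      obtain p where p: "x *v p + v = p"
        using finite_order_imp_fixed_point[OF x m(1)] m(2) by (auto simp: g_def)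
      obtain p' where p': "x' *v p' + v' = p'"
        using finite_order_imp_fixed_point[OF x' m(1)] ym by (auto simp: y_eq)
      have "h *v v = h *v p - h *v (x *v p)"
        using p by (metis add_diff_cancel_left' matrix_vector_mult_diff_distrib)
      moreover have "h *v (x *v p) = x' *v (h *v p)"
        using hx by (simp add: matrix_vector_mul_assoc)
      ultimately have "h *v v + (p' - h *v p) = x' *v (p' - h *v p) + v'"
        using p' by (simp add: matrix_vector_mult_diff_distrib algebra_simps)
      (* The conjugating element maps the fixed point p to p'. *)
      then show ?thesis
        unfolding y_eq g_def by (rule affine_conjugateI[OF x x' h_inv hx])
    next
      case False
      have "g [^]\<^bsub>AGL\<^esub> (k * l) = g [^]\<^bsub>AGL\<^esub> (1::int)"
        using k l g by (simp add: AGL.int_pow_pow[symmetric])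
      then have "g [^]\<^bsub>AGL\<^esub> (k * l - 1) = \<one>\<^bsub>AGL\<^esub>"
        using g AGL.int_pow_diff[OF g, of "k * l" 1] by simp
      moreover obtain n where n: "k * l - 1 = int n \<or> k * l - 1 = - int n"
        by (cases "k * l - 1" rule: int_cases2) blast+
      ultimately have "g [^]\<^bsub>AGL\<^esub> int n = \<one>\<^bsub>AGL\<^esub> \<or> g [^]\<^bsub>AGL\<^esub> (- int n) = \<one>\<^bsub>AGL\<^esub>"
        by metis
      then have "g [^]\<^bsub>AGL\<^esub> int n = \<one>\<^bsub>AGL\<^esub>"
        unfolding AGL.int_pow_neg[OF g] AGL.inv_eq_1_iff[OF AGL.int_pow_closed[OF g]] by blast
      then have gn: "g [^]\<^bsub>AGL\<^esub> n = \<one>\<^bsub>AGL\<^esub>" by (simp add: int_pow_int)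
      have "\<not> 0 < n"
      proof
        assume "0 < n"
        from False conjI[OF this gn] show False by (rule notE[OF _ exI])
      qed
      then have "n = 0" by simp
      with n have "k * l = 1" by simp
      then have "k = 1 \<or> k = -1" by (auto simp: zmult_eq_1_iff)
      then show ?thesis
      proof
        assume "k = 1"
        then have "y = \<one>\<^bsub>AGL\<^esub> \<otimes>\<^bsub>AGL\<^esub> g \<otimes>\<^bsub>AGL\<^esub> inv\<^bsub>AGL\<^esub> \<one>\<^bsub>AGL\<^esub>" using k g by simp
        then show ?thesis by blast
      next
        assume "k = -1"
        then have "y = inv\<^bsub>AGL\<^esub> g" using k g by (simp add: AGL.int_pow_neg)
        then have "y \<otimes>\<^bsub>AGL\<^esub> g = \<one>\<^bsub>AGL\<^esub>" using g by simp
        then have "affine_mat (x' ** x) (x' *v v + v') = affine_mat (mat 1) 0"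
          unfolding y_eq g_def mult_AGL_affine_mat affine_mat_one by (simp add: AGL_def)
        then have "x' ** x = mat 1" and "v' = - (x' *v v)"
          by (simp_all add: affine_mat_inject eq_neg_iff_add_eq_0 add.commute)
        moreover from this have "x ** x' = mat 1" using matrix_left_right_inverse by blast
        ultimately show ?thesis
          unfolding y_eq g_def using reversible_imp_affine_conjugate_inv h_inv hx by blast
      qed
    qed
  qed
  then show "rational_in AGL (affine_mat x v)"
    using g unfolding rational_in_def g_def by blast
qed

end
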